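(* Let $p,q\in L^2([0,1],\mathbb{R})$ and $\alpha\in[-\pi/2,\pi/2)$. 1. Let $w(x)=(c(x),d(x))^T$ be the second column of the coefficient matrix $K_0^S(x)$. Then the potential $Q$ can be recovered from the equality, valid for almost every $x\in[0,1]$, $$\begin{pmatrix}p\\ q\end{pmatrix}=\frac1{(1+2d)^2+4c^2}\begin{pmatrix}-(1+2d)&-2c\\ 2c&-(1+2d)\end{pmatrix}\begin{pmatrix}2c'\\ 2d'\end{pmatrix}.$$ 2. Let $w_\alpha(x)=(c_\alpha(x),d_\alpha(x))^T$ be the second column of the coefficient matrix $K_0^\alpha(x)$. Then the potential $Q$ can be recovered from the equality, valid for almost every $x\in[0,1]$, $$\begin{pmatrix}p\\ q\end{pmatrix}=\frac1{(\cos\alpha+2d_\alpha)^2+(\sin\alpha-2c_\alpha)^2}\begin{pmatrix}-(\cos\alpha+2d_\alpha)&\sin\alpha-2c_\alpha\\ -\sin\alpha+2c_\alpha&-(\cos\alpha+2d_\alpha)\end{pmatrix}\begin{pmatrix}2c_\alpha'\\ 2d_\alpha'\end{pmatrix}.$$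
   Context: Let $B=\begin{pmatrix}0&1\\ -1&0\end{pmatrix}$ and $Q(x)=\begin{pmatrix}p(x)&q(x)\\ q(x)&-p(x)\end{pmatrix}$. $P_n$ is the $n$-th Legendre polynomial and $\mathcal{M}_2$ the space of $2\times2$ complex matrices. It is known that there is a matrix-valued kernel $K(x,t)$ with $K(x,\cdot)\in L^2([-x,x],\mathcal{M}_2)$ such that the matrix solution $U(\lambda,x)$ of $BU'+QU=\lambda U$ on $[0,1]$, $U(\lambda,0)=I$, is $U(\lambda,x)=e^{-B\lambda x}+\int_{-x}^xK(x,t)e^{-B\lambda t}dt$ for all $\lambda\in\mathbb{C}$. For $x>0$ write $K(x,t)=\sum_{n=0}^\infty\frac1xK_n(x)P_n(t/x)$ (convergent in $L^2((-x,x),\mathcal{M}_2)$), $K_n(x)=\left(K_{ij}^{(n)}(x)\right)_{i,j=1}^2$, i.e. $K_n(x)=\frac{2n+1}{2}\int_{-x}^xK(x,t)P_n(t/x)\,dt$. Define $$K_n^S(x)=\begin{pmatrix}K_{11}^{(2n+1)}(x)&K_{12}^{(2n)}(x)\\ K_{21}^{(2n+1)}(x)&K_{22}^{(2n)}(x)\end{pmatrix},$$ $$K_n^\alpha(x)=\begin{pmatrix}\cos\alpha\,K_{11}^{(2n+1)}(x)+\sin\alpha\,K_{12}^{(2n+1)}(x)&-\sin\alpha\,K_{11}^{(2n)}(x)+\cos\alpha\,K_{12}^{(2n)}(x)\\ \cos\alpha\,K_{21}^{(2n+1)}(x)+\sin\alpha\,K_{22}^{(2n+1)}(x)&-\sin\alpha\,K_{21}^{(2n)}(x)+\cos\alpha\,K_{22}^{(2n)}(x)\end{pmatrix}.$$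 *)

theory Defs
  imports "HOL-Analysis.Analysis" "HOL-Computational_Algebra.Polynomial"
begin

definition square_integrable_on ::
    "(real \<Rightarrow> 'a::real_normed_vector) \<Rightarrow> real set \<Rightarrow> bool"  (infixr \<open>square'_integrable'_on\<close> 46)
  where "f square_integrable_on S \<longleftrightarrow>
    f \<in> borel_measurable (lebesgue_on S) \<and> integrable (lebesgue_on S) (\<lambda>x. (norm (f x))\<^sup>2)"

definition absolutely_continuous_fun_on :: "real set \<Rightarrow> (real \<Rightarrow> 'a::metric_space) \<Rightarrow> bool"
  where "absolutely_continuous_fun_on S f \<longleftrightarrow>
    (\<forall>\<epsilon>>0. \<exists>\<delta>>0. \<forall>(n::nat) a b.
        (\<forall>i<n. a i \<le> b i \<and> {a i..b i} \<subseteq> S) \<longrightarrow>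
        (\<forall>i<n. \<forall>j<n. i \<noteq> j \<longrightarrow> {a i<..<b i} \<inter> {a j<..<b j} = {}) \<longrightarrow>
        (\<Sum>i<n. b i - a i) < \<delta> \<longrightarrow>
        (\<Sum>i<n. dist (f (a i)) (f (b i))) < \<epsilon>)"

definition B_mat :: "complex^2^2"
  where "B_mat = vector [vector [0, 1], vector [-1, 0]]"

definition Q_mat :: "(real \<Rightarrow> real) \<Rightarrow> (real \<Rightarrow> real) \<Rightarrow> real \<Rightarrow> complex^2^2"
  where "Q_mat p q x =
    vector [vector [of_real (p x), of_real (q x)], vector [of_real (q x), - of_real (p x)]]"

text \<open>The library has neither powers nor an exponential for \<^term>\<open>(**)\<close> (multiplication and
  \<^term>\<open>(^)\<close> on vectors are componentwise). Complex multiples of a matrix are written as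
  products with a scalar matrix \<^term>\<open>mat \<mu>\<close>.\<close>

definition matrix_exp :: "complex^2^2 \<Rightarrow> complex^2^2"
  where "matrix_exp A = (\<Sum>n. (1 / fact n) *\<^sub>R (((**) A ^^ n) (mat 1)))"

text \<open>Solutions are understood in the Caratheodory sense, as \<^term>\<open>p\<close> and \<^term>\<open>q\<close> are only
  square integrable.\<close>

definition matrix_solution ::
    "(real \<Rightarrow> real) \<Rightarrow> (real \<Rightarrow> real) \<Rightarrow> complex \<Rightarrow> (real \<Rightarrow> complex^2^2) \<Rightarrow> bool"
  where "matrix_solution p q \<mu> U \<longleftrightarrow>
    absolutely_continuous_fun_on {0..1} U \<and> U 0 = mat 1 \<and>
    (AE x in lebesgue_on {0..1}. \<exists>U'. (U has_vector_derivative U') (at x within {0..1}) \<and>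
        B_mat ** U' + Q_mat p q x ** U x = mat \<mu> ** U x)"

definition transmutation_kernel ::
    "(complex \<Rightarrow> real \<Rightarrow> complex^2^2) \<Rightarrow> (real \<Rightarrow> real \<Rightarrow> complex^2^2) \<Rightarrow> bool"
  where "transmutation_kernel U K \<longleftrightarrow>
    (\<forall>x\<in>{0..1}. K x square_integrable_on {-x..x} \<and>
      (\<forall>\<mu>. U \<mu> x = matrix_exp (mat (- \<mu> * of_real x) ** B_mat) +
        (LINT t|lebesgue_on {-x..x}. K x t ** matrix_exp (mat (- \<mu> * of_real t) ** B_mat))))"

text \<open>Rodrigues' formula.\<close>

definition legendre_poly :: "nat \<Rightarrow> real poly"
  where "legendre_poly n = smult (1 / (2 ^ n * fact n)) ((pderiv ^^ n) ([:-1, 0, 1:] ^ n))"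

definition kernel_coeff :: "(real \<Rightarrow> real \<Rightarrow> complex^2^2) \<Rightarrow> nat \<Rightarrow> real \<Rightarrow> complex^2^2"
  where "kernel_coeff K n x =
    ((2 * real n + 1) / 2) *\<^sub>R
      (LINT t|lebesgue_on {-x..x}. poly (legendre_poly n) (t / x) *\<^sub>R K x t)"

definition K_S :: "(real \<Rightarrow> real \<Rightarrow> complex^2^2) \<Rightarrow> nat \<Rightarrow> real \<Rightarrow> complex^2^2"
  where "K_S K n x =
    (let E = kernel_coeff K (2 * n) x; D = kernel_coeff K (2 * n + 1) x
     in vector [vector [D$1$1, E$1$2],
                vector [D$2$1, E$2$2]])"

definition K_alpha :: "real \<Rightarrow> (real \<Rightarrow> real \<Rightarrow> complex^2^2) \<Rightarrow> nat \<Rightarrow> real \<Rightarrow> complex^2^2"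
  where "K_alpha \<alpha> K n x =
    (let E = kernel_coeff K (2 * n) x; D = kernel_coeff K (2 * n + 1) x;
         C = complex_of_real (cos \<alpha>); S = complex_of_real (sin \<alpha>)
     in vector [vector [C * D$1$1 + S * D$1$2, - S * E$1$1 + C * E$1$2],
                vector [C * D$2$1 + S * D$2$2, - S * E$2$1 + C * E$2$2]])"

end

theory Submission
  imports Defs
begin

text \<open>
  At \<open>\<lambda> = 0\<close> the transmutation formula reads \<open>U(0,x) = I + \<integral> K(x,t) dt = I + 2 K\<^sub>0(x)\<close>
  (\<open>kernel_coeff_0\<close>). Hence for a constant vector \<open>v\<close> the function \<open>u = U(0,\<cdot>) v = v + 2 K\<^sub>0 v\<close>
  solves \<open>B u' + Q u = 0\<close> and is known once \<open>K\<^sub>0 v\<close> is. The second column of \<open>K_S K 0\<close> is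
  \<open>K\<^sub>0 v\<close> for \<open>v = (0, 1)\<close>, that of \<open>K_alpha \<alpha> K 0\<close> for \<open>v = (- sin \<alpha>, cos \<alpha>)\<close>.

  The matrix \<open>Q\<close> has only two free entries, so the two scalar equations in \<open>B u' + Q u = 0\<close> can be
  solved for \<open>p\<close> and \<open>q\<close> wherever \<open>u\<^sub>1\<^sup>2 + u\<^sub>2\<^sup>2 \<noteq> 0\<close>; this is the asserted formula
  (\<open>potential_recovery\<close>).

  The point that needs proof is that this sum of squares, formed from complex numbers, does not vanish.
  It follows from \<open>U(0,\<cdot>)\<close> being real with determinant one (\<open>matrix_solution_real_det\<close>), and both facts
  come from constancy of Wronskians (\<open>wronskian_constant\<close>) of the columns of \<open>U(0,\<cdot>)\<close> and of their
  complex conjugates. As solutions are only absolutely continuous, this constancy rests on the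
  theorem that an absolutely continuous function with zero derivative almost everywhere is constant
  (\<open>absolutely_continuous_zero_derivative_imp_eq\<close>).
\<close>

section \<open>Absolutely continuous functions\<close>

text \<open>Partial divisions of an interval arise below as finite sets of tagged intervals, so the defining
  property is transferred from families numbered by an initial segment of \<open>nat\<close> to arbitrary
  finite index sets.\<close>

lemma absolutely_continuous_fun_on_finite_family:
  fixes f :: "real \<Rightarrow> 'a::metric_space"
  assumes "absolutely_continuous_fun_on S f" and "e > 0"
  shows "\<exists>d>0. \<forall>(I :: 'i set) l r. finite I \<longrightarrow> (\<forall>i\<in>I. l i \<le> r i \<and> {l i..r i} \<subseteq> S) \<longrightarrow>
           disjoint_family_on (\<lambda>i. {l i<..<r i}) I \<longrightarrow> (\<Sum>i\<in>I. r i - l i) < d \<longrightarrow>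
           (\<Sum>i\<in>I. dist (f (l i)) (f (r i))) < e"
proof -
  obtain d where "d > 0" and d: "\<forall>(n::nat) a b.
        (\<forall>i<n. a i \<le> b i \<and> {a i..b i} \<subseteq> S) \<longrightarrow>
        (\<forall>i<n. \<forall>j<n. i \<noteq> j \<longrightarrow> {a i<..<b i} \<inter> {a j<..<b j} = {}) \<longrightarrow>
        (\<Sum>i<n. b i - a i) < d \<longrightarrow>
        (\<Sum>i<n. dist (f (a i)) (f (b i))) < e"
    using assms(1)[unfolded absolutely_continuous_fun_on_def, THEN spec, THEN mp, OF \<open>e > 0\<close>]
    by (elim exE conjE) (rule that)
  show ?thesis
  proof (intro exI[of _ d] conjI allI impI)
    fix I :: "'i set" and a b
    assume I: "finite I" "\<forall>i\<in>I. a i \<le> b i \<and> {a i..b i} \<subseteq> S"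
      and dj: "disjoint_family_on (\<lambda>i. {a i<..<b i}) I"
      and len: "(\<Sum>i\<in>I. b i - a i) < d"
    obtain h where h: "bij_betw h {..<card I} I"
      using ex_bij_betw_nat_finite[OF \<open>finite I\<close>] by (auto simp: atLeast0LessThan)
    have "(\<Sum>i<card I. dist (f (a (h i))) (f (b (h i)))) < e"
    proof (rule d[THEN spec, THEN spec, THEN spec, THEN mp, THEN mp, THEN mp])
      show "\<forall>i<card I. a (h i) \<le> b (h i) \<and> {a (h i)..b (h i)} \<subseteq> S"
        using I(2) h by (auto simp: bij_betw_def)
      show "\<forall>i<card I. \<forall>j<card I. i \<noteq> j \<longrightarrow> {a (h i)<..<b (h i)} \<inter> {a (h j)<..<b (h j)} = {}"
      proof (intro allI impI)
        fix i j assume "i < card I" "j < card I" "i \<noteq> j"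
        then have "h i \<in> I" "h j \<in> I" "h i \<noteq> h j"
          using h by (auto simp: bij_betw_def inj_on_def)
        then show "{a (h i)<..<b (h i)} \<inter> {a (h j)<..<b (h j)} = {}"
          using dj unfolding disjoint_family_on_def by blast
      qed
      show "(\<Sum>i<card I. b (h i) - a (h i)) < d"
        using len sum.reindex_bij_betw[OF h, of "\<lambda>i. b i - a i"] by simp
    qed
    then show "(\<Sum>i\<in>I. dist (f (a i)) (f (b i))) < e"
      using sum.reindex_bij_betw[OF h, of "\<lambda>i. dist (f (a i)) (f (b i))"] by simp
  qed (rule \<open>d > 0\<close>)
qed

text \<open>Off a null set \<open>N\<close>, the increment of \<open>f\<close> over a short interval tagged at \<open>x\<close> is at most
  \<open>e\<close> times its length. Cover \<open>N\<close> by an open set \<open>T\<close> of measure below the \<open>d\<close> that absolute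
  continuity assigns to \<open>e\<close>, and choose a tagged division whose intervals lie in \<open>T\<close> when the tag is
  in \<open>N\<close> and are short otherwise. The intervals tagged in \<open>N\<close> contribute less than \<open>e\<close> in total,
  by absolute continuity; the others contribute at most \<open>e * (b - a)\<close>. Working with a gauge in place of
  a Vitali cover makes the division exhaust the interval, so that the increments telescope.\<close>

lemma absolutely_continuous_zero_derivative_imp_eq:
  fixes f :: "real \<Rightarrow> 'a::real_normed_vector"
  assumes ac: "absolutely_continuous_fun_on {a..b} f" and "a \<le> b"
    and deriv: "AE x in lebesgue_on {a..b}. (f has_vector_derivative 0) (at x within {a..b})"
  shows "f b = f a"
proof -
  obtain N where N: "N \<in> null_sets lebesgue"
    and f0: "\<And>x. x \<in> {a..b} - N \<Longrightarrow> (f has_vector_derivative 0) (at x within {a..b})"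
  proof -
    have "AE x in lebesgue. x \<in> {a..b} \<longrightarrow> (f has_vector_derivative 0) (at x within {a..b})"
      using deriv by (simp add: AE_restrict_space_iff)
    then obtain N where "N \<in> null_sets lebesgue"
      "{x \<in> space lebesgue. \<not> (x \<in> {a..b} \<longrightarrow> (f has_vector_derivative 0) (at x within {a..b}))} \<subseteq> N"
      unfolding eventually_ae_filter by blast
    then show thesis
      by (intro that[of N]) auto
  qed
  have small: "norm (f b - f a) \<le> e * (b - a) + e" if "e > 0" for e
  proof -
    obtain d where "d > 0"
      and d: "\<forall>(I :: (real \<times> real set) set) l r. finite I \<longrightarrow>
           (\<forall>i\<in>I. l i \<le> r i \<and> {l i..r i} \<subseteq> {a..b}) \<longrightarrow>
           disjoint_family_on (\<lambda>i. {l i<..<r i}) I \<longrightarrow> (\<Sum>i\<in>I. r i - l i) < d \<longrightarrow>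
           (\<Sum>i\<in>I. dist (f (l i)) (f (r i))) < e"
      using absolutely_continuous_fun_on_finite_family[OF ac \<open>e > 0\<close>] by (elim exE conjE) (rule that)
    obtain T where T: "open T" "N \<subseteq> T" "emeasure lebesgue T < ennreal d"
    proof -
      obtain T where T: "open T" "N \<subseteq> T" "(T - N) \<in> lmeasurable"
          "emeasure lebesgue (T - N) < ennreal d"
        using sets_lebesgue_outer_open[of N d] N \<open>d > 0\<close> by blast
      have "emeasure lebesgue T = emeasure lebesgue (T - N)"
        using N T by (simp add: emeasure_Diff_null_set)
      with T that show thesis by metis
    qed
    have Tm: "T \<in> lmeasurable"
      using T by (intro fmeasurableI) (auto simp: less_top[symmetric] top_unique)
    have "\<exists>r>0. x \<in> {a..b} - N \<longrightarrow>
            (\<forall>y\<in>{a..b}. dist y x < r \<longrightarrow> norm (f y - f x) \<le> e * \<bar>y - x\<bar>)" for x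
    proof (cases "x \<in> {a..b} - N")
      case True
      from f0[OF this] show ?thesis
        using \<open>e > 0\<close> unfolding has_vector_derivative_def has_derivative_within_alt
        by (auto simp: dist_norm)
    qed (auto intro: exI[of _ 1])
    then obtain r where r0: "\<And>x. r x > 0"
      and r: "\<And>x y. x \<in> {a..b} - N \<Longrightarrow> y \<in> {a..b} \<Longrightarrow> dist y x < r x \<Longrightarrow>
                norm (f y - f x) \<le> e * \<bar>y - x\<bar>"
      by metis
    \<comment> \<open>Being fine for \<open>g\<close> puts the intervals tagged in \<open>N\<close> inside \<open>T\<close>, which bounds their total length.\<close>
    define g where "g x = (if x \<in> N then T else ball x (r x))" for x
    have "gauge g"
      using T r0 by (auto simp: gauge_def g_def)
    then obtain P where P: "P tagged_division_of {a..b}" "g fine P"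
      by (rule fine_division_exists_real)
    define l where "l = (\<lambda>i :: real \<times> real set. Inf (snd i))"
    define u where "u = (\<lambda>i :: real \<times> real set. Sup (snd i))"
    have "finite P" using P by blast
    have el: "fst i \<in> {l i..u i}" "snd i = {l i..u i}" "l i \<le> u i" "{l i..u i} \<subseteq> {a..b}" if "i \<in> P" for i
    proof -
      obtain x k where i: "i = (x, k)" by fastforce
      obtain s t where k: "k = cbox s t" using P \<open>i \<in> P\<close> i by blast
      have "x \<in> k" "k \<subseteq> {a..b}" using P \<open>i \<in> P\<close> i by blast+
      moreover from \<open>x \<in> k\<close> have "l i = s" "u i = t" unfolding l_def u_def i k by auto
      ultimately show "fst i \<in> {l i..u i}" "snd i = {l i..u i}" "l i \<le> u i" "{l i..u i} \<subseteq> {a..b}"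
        using k i by auto
    qed
    have dj: "disjoint_family_on (\<lambda>i. {l i<..<u i}) P"
    proof (unfold disjoint_family_on_def, intro ballI impI)
      fix i j assume ij: "i \<in> P" "j \<in> P" "i \<noteq> j"
      then have "interior (snd i) \<inter> interior (snd j) = {}"
        using tagged_division_ofD(5)[OF P(1)] by (metis prod.collapse)
      then show "{l i<..<u i} \<inter> {l j<..<u j} = {}"
        using el(2) ij by simp
    qed
    \<comment> \<open>The intervals on which nothing is known about the derivative.\<close>
    define A where "A = {i \<in> P. fst i \<in> N}"
    have "A \<subseteq> P" by (auto simp: A_def)
    then have "finite A" using \<open>finite P\<close> by (rule finite_subset)
    have bad: "(\<Sum>i\<in>A. norm (f (u i) - f (l i))) < e"
    proof -
      have djA: "disjoint_family_on (\<lambda>i. {l i<..<u i}) A"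
        using dj \<open>A \<subseteq> P\<close> by (rule disjoint_family_on_mono[rotated])
      have "(\<Sum>i\<in>A. u i - l i) = (\<Sum>i\<in>A. measure lebesgue {l i<..<u i})"
        using el(3) \<open>A \<subseteq> P\<close> by (intro sum.cong) auto
      also have "\<dots> = measure lebesgue (\<Union>i\<in>A. {l i<..<u i})"
        using \<open>finite A\<close> djA el(3) \<open>A \<subseteq> P\<close>
        by (intro measure_finite_Union[symmetric]) (auto simp: subset_iff)
      also have "\<dots> \<le> measure lebesgue T"
      proof (rule measure_mono_fmeasurable)
        show "(\<Union>i\<in>A. {l i<..<u i}) \<subseteq> T"
        proof
          fix y assume "y \<in> (\<Union>i\<in>A. {l i<..<u i})"
          then obtain i where i: "i \<in> A" "y \<in> snd i"
            using el(2) \<open>A \<subseteq> P\<close> by force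
          then have "snd i \<subseteq> g (fst i)"
            using P(2) \<open>A \<subseteq> P\<close> unfolding fine_def by (metis subsetD prod.collapse case_prodD)
          then show "y \<in> T" using i by (auto simp: A_def g_def)
        qed
      qed (use \<open>finite A\<close> Tm in auto)
      also have "\<dots> < d"
        using T(3) Tm \<open>d > 0\<close> by (simp add: emeasure_eq_measure2 ennreal_less_iff)
      finally have "(\<Sum>i\<in>A. dist (f (l i)) (f (u i))) < e"
        using \<open>finite A\<close> djA el(3,4) \<open>A \<subseteq> P\<close> by (intro d[rule_format]) auto
      then show ?thesis by (simp add: dist_norm norm_minus_commute)
    qed
    have good: "(\<Sum>i\<in>P - A. norm (f (u i) - f (l i))) \<le> e * (b - a)"
    proof -
      have "norm (f (u i) - f (l i)) \<le> e * (u i - l i)" if "i \<in> P - A" for i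
      proof -
        let ?x = "fst i"
        have "i \<in> P" using that by simp
        note el = el[OF this]
        have "?x \<in> {a..b} - N" using that el by (auto simp: A_def)
        have "snd i \<subseteq> g ?x"
          using P(2) \<open>i \<in> P\<close> unfolding fine_def by (metis prod.collapse case_prodD)
        moreover have "l i \<in> snd i" "u i \<in> snd i"
          using el by auto
        ultimately have "l i \<in> ball ?x (r ?x)" "u i \<in> ball ?x (r ?x)"
          using \<open>?x \<in> {a..b} - N\<close> by (auto simp: g_def)
        then have dl: "dist (l i) ?x < r ?x" and du: "dist (u i) ?x < r ?x"
          by (simp_all add: dist_commute)
        have "l i \<in> {a..b}" "u i \<in> {a..b}"
          using el(3,4) by auto
        then have "norm (f (l i) - f ?x) \<le> e * \<bar>l i - ?x\<bar>" "norm (f (u i) - f ?x) \<le> e * \<bar>u i - ?x\<bar>"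
          using r[OF \<open>?x \<in> {a..b} - N\<close> _ dl] r[OF \<open>?x \<in> {a..b} - N\<close> _ du] by simp_all
        moreover have "norm (f (u i) - f (l i)) \<le> norm (f (l i) - f ?x) + norm (f (u i) - f ?x)"
          by norm
        moreover have "\<bar>l i - ?x\<bar> = ?x - l i" "\<bar>u i - ?x\<bar> = u i - ?x" using el by auto
        ultimately show ?thesis by (simp add: algebra_simps)
      qed
      then have "(\<Sum>i\<in>P - A. norm (f (u i) - f (l i))) \<le> (\<Sum>i\<in>P - A. e * (u i - l i))"
        by (rule sum_mono)
      also have "\<dots> \<le> (\<Sum>i\<in>P. e * (u i - l i))"
        using \<open>finite P\<close> el(3) \<open>e > 0\<close> by (intro sum_mono2) auto
      also have "\<dots> = e * (\<Sum>i\<in>P. u i - l i)"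
        by (simp add: sum_distrib_left)
      also have "(\<Sum>i\<in>P. u i - l i) = b - a"
        using additive_tagged_division_1[OF \<open>a \<le> b\<close> P(1), of "\<lambda>x. x"]
        by (simp add: l_def u_def case_prod_beta)
      finally show ?thesis .
    qed
    \<comment> \<open>The increments over the whole division telescope.\<close>
    have "f b - f a = (\<Sum>i\<in>P. f (u i) - f (l i))"
      using additive_tagged_division_1[OF \<open>a \<le> b\<close> P(1), of f]
      by (simp add: l_def u_def case_prod_beta)
    then have "norm (f b - f a) \<le> (\<Sum>i\<in>P. norm (f (u i) - f (l i)))"
      by (simp add: norm_sum)
    also have "\<dots> = (\<Sum>i\<in>P - A. norm (f (u i) - f (l i))) + (\<Sum>i\<in>A. norm (f (u i) - f (l i)))"
      using \<open>finite P\<close> \<open>A \<subseteq> P\<close> by (rule sum.subset_diff[rotated])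
    finally show ?thesis using good bad by linarith
  qed
  have "norm (f b - f a) \<le> e" if "e > 0" for e
  proof -
    have "norm (f b - f a) \<le> e / (b - a + 1) * (b - a) + e / (b - a + 1)"
      using \<open>e > 0\<close> \<open>a \<le> b\<close> by (intro small) (simp add: divide_pos_pos)
    also have "\<dots> = e / (b - a + 1) * (b - a + 1)"
      by (simp only: distrib_left mult_1_right)
    also have "\<dots> = e"
      using \<open>a \<le> b\<close> by simp
    finally show ?thesis .
  qed
  then have "norm (f b - f a) \<le> 0"
    by (rule field_le_epsilon) simp
  then show ?thesis by simp
qed

text \<open>A function whose variation is controlled by the variations of two absolutely continuous functions
  is absolutely continuous. The closure properties below are instances: a difference, a product, a
  linear image and a restriction each satisfy such an estimate.\<close>

lemma absolutely_continuous_fun_on_dominated: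
  assumes f: "absolutely_continuous_fun_on S f" and g: "absolutely_continuous_fun_on S g"
    and "T \<subseteq> S"
    and h: "\<And>x y. x \<in> T \<Longrightarrow> y \<in> T \<Longrightarrow> dist (h x) (h y) \<le> M * (dist (f x) (f y) + dist (g x) (g y))"
  shows "absolutely_continuous_fun_on T h"
  unfolding absolutely_continuous_fun_on_def
proof (intro allI impI)
  fix e :: real assume "e > 0"
  define e' where "e' = e / (2 * (\<bar>M\<bar> + 1))"
  have "e' > 0" using \<open>e > 0\<close> by (simp add: e'_def add_nonneg_pos)
  obtain d1 where "d1 > 0" and d1: "\<forall>(I :: nat set) l r. finite I \<longrightarrow>
           (\<forall>i\<in>I. l i \<le> r i \<and> {l i..r i} \<subseteq> S) \<longrightarrow>
           disjoint_family_on (\<lambda>i. {l i<..<r i}) I \<longrightarrow> (\<Sum>i\<in>I. r i - l i) < d1 \<longrightarrow>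
           (\<Sum>i\<in>I. dist (f (l i)) (f (r i))) < e'"
    using absolutely_continuous_fun_on_finite_family[OF f \<open>e' > 0\<close>] by (elim exE conjE) (rule that)
  obtain d2 where "d2 > 0" and d2: "\<forall>(I :: nat set) l r. finite I \<longrightarrow>
           (\<forall>i\<in>I. l i \<le> r i \<and> {l i..r i} \<subseteq> S) \<longrightarrow>
           disjoint_family_on (\<lambda>i. {l i<..<r i}) I \<longrightarrow> (\<Sum>i\<in>I. r i - l i) < d2 \<longrightarrow>
           (\<Sum>i\<in>I. dist (g (l i)) (g (r i))) < e'"
    using absolutely_continuous_fun_on_finite_family[OF g \<open>e' > 0\<close>] by (elim exE conjE) (rule that)
  show "\<exists>d>0. \<forall>(n::nat) a b.
        (\<forall>i<n. a i \<le> b i \<and> {a i..b i} \<subseteq> T) \<longrightarrow>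
        (\<forall>i<n. \<forall>j<n. i \<noteq> j \<longrightarrow> {a i<..<b i} \<inter> {a j<..<b j} = {}) \<longrightarrow>
        (\<Sum>i<n. b i - a i) < d \<longrightarrow>
        (\<Sum>i<n. dist (h (a i)) (h (b i))) < e"
  proof (intro exI[of _ "min d1 d2"] conjI allI impI)
    fix n :: nat and a b
    assume T: "\<forall>i<n. a i \<le> b i \<and> {a i..b i} \<subseteq> T"
      and dj: "\<forall>i<n. \<forall>j<n. i \<noteq> j \<longrightarrow> {a i<..<b i} \<inter> {a j<..<b j} = {}"
      and len: "(\<Sum>i<n. b i - a i) < min d1 d2"
    have S: "\<And>i. i \<in> {..<n} \<Longrightarrow> a i \<le> b i \<and> {a i..b i} \<subseteq> S"
      using T \<open>T \<subseteq> S\<close> by blast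
    have dj': "disjoint_family_on (\<lambda>i. {a i<..<b i}) {..<n}"
      using dj by (auto simp: disjoint_family_on_def)
    have "(\<Sum>i<n. dist (h (a i)) (h (b i)))
        \<le> (\<Sum>i<n. (\<bar>M\<bar> + 1) * (dist (f (a i)) (f (b i)) + dist (g (a i)) (g (b i))))"
    proof (rule sum_mono)
      fix i assume "i \<in> {..<n}"
      then have "a i \<in> T" "b i \<in> T" using T by force+
      then have "dist (h (a i)) (h (b i)) \<le> M * (dist (f (a i)) (f (b i)) + dist (g (a i)) (g (b i)))"
        by (rule h)
      also have "\<dots> \<le> (\<bar>M\<bar> + 1) * (dist (f (a i)) (f (b i)) + dist (g (a i)) (g (b i)))"
        by (intro mult_right_mono) auto
      finally show "dist (h (a i)) (h (b i)) \<le> \<dots>" .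
    qed
    also have "\<dots> = (\<bar>M\<bar> + 1) * ((\<Sum>i<n. dist (f (a i)) (f (b i))) + (\<Sum>i<n. dist (g (a i)) (g (b i))))"
      by (simp only: sum_distrib_left[symmetric] sum.distrib)
    also have "\<dots> < (\<bar>M\<bar> + 1) * (e' + e')"
      using S dj' len
      by (intro mult_strict_left_mono add_strict_mono d1[rule_format] d2[rule_format]) auto
    also have "\<dots> = e"
      by (simp add: e'_def field_simps add_nonneg_eq_0_iff)
    finally show "(\<Sum>i<n. dist (h (a i)) (h (b i))) < e" .
  qed (use \<open>d1 > 0\<close> \<open>d2 > 0\<close> in auto)
qed

lemma absolutely_continuous_fun_on_imp_continuous_on:
  assumes "absolutely_continuous_fun_on {a..b} f"
  shows "continuous_on {a..b} f"
  unfolding continuous_on_iff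
proof (intro ballI allI impI)
  fix x e :: real assume "x \<in> {a..b}" "e > 0"
  obtain d where "d > 0" and d: "\<forall>(I :: unit set) l r. finite I \<longrightarrow>
           (\<forall>i\<in>I. l i \<le> r i \<and> {l i..r i} \<subseteq> {a..b}) \<longrightarrow>
           disjoint_family_on (\<lambda>i. {l i<..<r i}) I \<longrightarrow> (\<Sum>i\<in>I. r i - l i) < d \<longrightarrow>
           (\<Sum>i\<in>I. dist (f (l i)) (f (r i))) < e"
    using absolutely_continuous_fun_on_finite_family[OF assms \<open>e > 0\<close>] by (elim exE conjE) (rule that)
  have "dist (f y) (f x) < e" if "y \<in> {a..b}" "dist y x < d" for y
  proof -
    \<comment> \<open>A one-element family consisting of the interval between \<open>x\<close> and \<open>y\<close>.\<close>
    have "dist (f (min x y)) (f (max x y)) < e"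
      using d[rule_format, of UNIV "\<lambda>_. min x y" "\<lambda>_. max x y"] that \<open>x \<in> {a..b}\<close>
      by (auto simp: disjoint_family_on_def UNIV_unit dist_real_def)
    then show ?thesis
      by (cases "x \<le> y") (auto simp: min_def max_def dist_commute split: if_splits)
  qed
  then show "\<exists>d>0. \<forall>y\<in>{a..b}. dist y x < d \<longrightarrow> dist (f y) (f x) < e"
    using \<open>d > 0\<close> by blast
qed

lemma absolutely_continuous_fun_on_subset:
  assumes "absolutely_continuous_fun_on S f" "T \<subseteq> S"
  shows "absolutely_continuous_fun_on T f"
  by (rule absolutely_continuous_fun_on_dominated[OF assms(1,1,2), of _ 1]) auto

lemma absolutely_continuous_fun_on_diff:
  fixes f g :: "real \<Rightarrow> 'a::real_normed_vector"
  assumes "absolutely_continuous_fun_on S f" "absolutely_continuous_fun_on S g"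
  shows "absolutely_continuous_fun_on S (\<lambda>x. f x - g x)"
proof (rule absolutely_continuous_fun_on_dominated[OF assms, of _ _ 1])
  fix x y
  have "f x - g x - (f y - g y) = (f x - f y) - (g x - g y)" by simp
  then show "dist (f x - g x) (f y - g y) \<le> 1 * (dist (f x) (f y) + dist (g x) (g y))"
    unfolding dist_norm by (simp only: norm_triangle_ineq4 mult_1_left)
qed simp

lemma absolutely_continuous_fun_on_bounded_linear:
  assumes f: "absolutely_continuous_fun_on S f" and "bounded_linear h"
  shows "absolutely_continuous_fun_on S (\<lambda>x. h (f x))"
proof -
  interpret h: bounded_linear h by fact
  obtain M where M: "M > 0" "\<And>x. norm (h x) \<le> norm x * M"
    using h.pos_bounded by blast
  show ?thesis
  proof (rule absolutely_continuous_fun_on_dominated[OF f f, of _ _ M])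
    fix x y
    have "dist (h (f x)) (h (f y)) \<le> dist (f x) (f y) * M"
      using M(2)[of "f x - f y"] by (simp add: dist_norm h.diff)
    also have "\<dots> \<le> M * (dist (f x) (f y) + dist (f x) (f y))"
      using M(1) by (simp add: algebra_simps)
    finally show "dist (h (f x)) (h (f y)) \<le> \<dots>" .
  qed simp
qed

lemma absolutely_continuous_fun_on_mult:
  fixes f g :: "real \<Rightarrow> 'a::real_normed_algebra"
  assumes f: "absolutely_continuous_fun_on {a..b} f" and g: "absolutely_continuous_fun_on {a..b} g"
  shows "absolutely_continuous_fun_on {a..b} (\<lambda>x. f x * g x)"
proof -
  have "bounded (f ` {a..b} \<union> g ` {a..b})"
    using f g by (auto intro!: compact_imp_bounded compact_continuous_image
        absolutely_continuous_fun_on_imp_continuous_on)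
  then obtain M where "\<forall>v \<in> f ` {a..b} \<union> g ` {a..b}. norm v \<le> M"
    by (auto simp only: bounded_iff)
  then have M: "norm (f x) \<le> M" "norm (g x) \<le> M" if "x \<in> {a..b}" for x
    using that by auto
  show ?thesis
  proof (rule absolutely_continuous_fun_on_dominated[OF f g, of _ _ M])
    fix x y assume xy: "x \<in> {a..b}" "y \<in> {a..b}"
    have "f x * g x - f y * g y = (f x - f y) * g x + f y * (g x - g y)"
      by (simp add: algebra_simps)
    then have "dist (f x * g x) (f y * g y) \<le> norm (f x - f y) * norm (g x) + norm (f y) * norm (g x - g y)"
      by (simp add: dist_norm norm_triangle_le add_mono norm_mult_ineq)
    also have "\<dots> \<le> norm (f x - f y) * M + M * norm (g x - g y)"
      using M xy by (intro add_mono mult_left_mono mult_right_mono) auto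
    finally show "dist (f x * g x) (f y * g y) \<le> M * (dist (f x) (f y) + dist (g x) (g y))"
      by (simp add: dist_norm algebra_simps)
  qed simp
qed

section \<open>The system at spectral parameter zero\<close>

text \<open>For \<open>\<lambda> = 0\<close> the system \<open>B U' + Q U = 0\<close> reads \<open>U' = B Q U\<close>, because \<open>B\<^sup>2 = -I\<close>, and the
  coefficient matrix \<open>B Q\<close> with rows \<open>(q, -p)\<close> and \<open>(-p, -q)\<close> has trace zero. This is Liouville's
  formula: the Wronskian of two solutions has derivative trace times Wronskian, hence zero almost
  everywhere, and being absolutely continuous it is constant.\<close>

lemma wronskian_constant:
  fixes p q :: "real \<Rightarrow> complex" and y1 z1 y2 z2 :: "real \<Rightarrow> complex"
  assumes ac: "absolutely_continuous_fun_on {a..b} y1" "absolutely_continuous_fun_on {a..b} z1"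
    "absolutely_continuous_fun_on {a..b} y2" "absolutely_continuous_fun_on {a..b} z2"
    and ode1: "AE x in lebesgue_on {a..b}.
        (y1 has_vector_derivative q x * y1 x - p x * z1 x) (at x within {a..b}) \<and>
        (z1 has_vector_derivative - p x * y1 x - q x * z1 x) (at x within {a..b})"
    and ode2: "AE x in lebesgue_on {a..b}.
        (y2 has_vector_derivative q x * y2 x - p x * z2 x) (at x within {a..b}) \<and>
        (z2 has_vector_derivative - p x * y2 x - q x * z2 x) (at x within {a..b})"
    and x: "x \<in> {a..b}"
  shows "y1 x * z2 x - z1 x * y2 x = y1 a * z2 a - z1 a * y2 a"
proof -
  define W where "W = (\<lambda>x. y1 x * z2 x - z1 x * y2 x)"
  have sub: "{a..x} \<subseteq> {a..b}" using x by auto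
  have "absolutely_continuous_fun_on {a..b} W"
    unfolding W_def
    by (rule absolutely_continuous_fun_on_diff[OF absolutely_continuous_fun_on_mult[OF ac(1,4)]
          absolutely_continuous_fun_on_mult[OF ac(2,3)]])
  then have "absolutely_continuous_fun_on {a..x} W"
    using sub by (rule absolutely_continuous_fun_on_subset)
  moreover have "AE t in lebesgue_on {a..b}. (W has_vector_derivative 0) (at t within {a..b})"
    using ode1 ode2
  proof eventually_elim
    case (elim t)
    then have y1: "(y1 has_vector_derivative q t * y1 t - p t * z1 t) (at t within {a..b})"
      and z1: "(z1 has_vector_derivative - p t * y1 t - q t * z1 t) (at t within {a..b})"
      and y2: "(y2 has_vector_derivative q t * y2 t - p t * z2 t) (at t within {a..b})"
      and z2: "(z2 has_vector_derivative - p t * y2 t - q t * z2 t) (at t within {a..b})"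
      by blast+
    show ?case
      unfolding W_def
      using has_vector_derivative_diff[OF has_vector_derivative_mult[OF y1 z2]
          has_vector_derivative_mult[OF z1 y2]]
      by (simp add: algebra_simps)
  qed
  then have "AE t in lebesgue. t \<in> {a..b} \<longrightarrow> (W has_vector_derivative 0) (at t within {a..b})"
    by (simp add: AE_restrict_space_iff)
  then have "AE t in lebesgue. t \<in> {a..x} \<longrightarrow> (W has_vector_derivative 0) (at t within {a..x})"
  proof eventually_elim
    case (elim t)
    then show ?case
      using has_vector_derivative_within_subset[OF _ sub] sub by auto
  qed
  then have "AE t in lebesgue_on {a..x}. (W has_vector_derivative 0) (at t within {a..x})"
    by (simp add: AE_restrict_space_iff)
  moreover have "a \<le> x" using x by simp
  ultimately have "W x = W a"
    using absolutely_continuous_zero_derivative_imp_eq[of a x W] by blast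
  then show ?thesis by (simp add: W_def)
qed

text \<open>Multiplication by \<open>B\<close> exchanges the rows of \<open>U'\<close> up to sign, so the first row of the matrix equation
  gives the derivatives in the second row of \<open>U\<close> and conversely. The columns thus solve the scalar system
  for which the Wronskian is constant.\<close>

lemma matrix_solution_columns:
  assumes "matrix_solution p q 0 U"
  shows "absolutely_continuous_fun_on {0..1} (\<lambda>x. U x $ i $ j)"
    and "U 0 $ i $ j = (if i = j then 1 else 0)"
    and "AE x in lebesgue_on {0..1}.
        ((\<lambda>x. U x $ 1 $ j) has_vector_derivative
            of_real (q x) * U x $ 1 $ j - of_real (p x) * U x $ 2 $ j) (at x within {0..1}) \<and>
        ((\<lambda>x. U x $ 2 $ j) has_vector_derivative
            - of_real (p x) * U x $ 1 $ j - of_real (q x) * U x $ 2 $ j) (at x within {0..1})"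
proof -
  have bl: "bounded_linear (\<lambda>A :: complex^2^2. A $ i $ j)" for i j
    by (intro bounded_linear_compose[OF bounded_linear_vec_nth bounded_linear_vec_nth])
  show "absolutely_continuous_fun_on {0..1} (\<lambda>x. U x $ i $ j)"
    using assms unfolding matrix_solution_def
    by (intro absolutely_continuous_fun_on_bounded_linear[OF _ bl]) auto
  show "U 0 $ i $ j = (if i = j then 1 else 0)"
    using assms unfolding matrix_solution_def by (simp add: mat_def)
  have "AE x in lebesgue_on {0..1}. \<exists>U'. (U has_vector_derivative U') (at x within {0..1}) \<and>
        B_mat ** U' + Q_mat p q x ** U x = mat 0 ** U x"
    using assms unfolding matrix_solution_def by blast
  then show "AE x in lebesgue_on {0..1}.
        ((\<lambda>x. U x $ 1 $ j) has_vector_derivative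
            of_real (q x) * U x $ 1 $ j - of_real (p x) * U x $ 2 $ j) (at x within {0..1}) \<and>
        ((\<lambda>x. U x $ 2 $ j) has_vector_derivative
            - of_real (p x) * U x $ 1 $ j - of_real (q x) * U x $ 2 $ j) (at x within {0..1})"
  proof eventually_elim
    case (elim x)
    then obtain U' where U': "(U has_vector_derivative U') (at x within {0..1})"
      and eq: "B_mat ** U' + Q_mat p q x ** U x = mat 0 ** U x" by blast
    have "(B_mat ** U' + Q_mat p q x ** U x) $ i $ j = 0" for i
      unfolding eq by (simp add: matrix_matrix_mult_def mat_def)
    from this[of 1] this[of 2]
    have "U' $ 2 $ j + (of_real (p x) * U x $ 1 $ j + of_real (q x) * U x $ 2 $ j) = 0"
      "- U' $ 1 $ j + (of_real (q x) * U x $ 1 $ j - of_real (p x) * U x $ 2 $ j) = 0"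
      by (simp_all add: matrix_matrix_mult_def B_mat_def Q_mat_def sum_2)
    then have "U' $ 2 $ j = - of_real (p x) * U x $ 1 $ j - of_real (q x) * U x $ 2 $ j"
      "U' $ 1 $ j = of_real (q x) * U x $ 1 $ j - of_real (p x) * U x $ 2 $ j"
      by algebra+
    then show ?case
      using bounded_linear.has_vector_derivative[OF bl U', of 1 j]
        bounded_linear.has_vector_derivative[OF bl U', of 2 j] by simp
  qed
qed

text \<open>The determinant is the Wronskian of the two columns. For reality, note that \<open>p\<close> and \<open>q\<close> are real, so
  the conjugates of the columns are solutions too. With \<open>J\<close> the symplectic matrix, the Wronskians of the columns
  among themselves give \<open>U\<^sup>T J U = J\<close>, and those of the conjugated columns with the columns give
  \<open>U\<^sup>* J U = J\<close>, where \<open>U\<^sup>*\<close> is the conjugate transpose. As \<open>J U\<close> is invertible, \<open>U\<^sup>T = U\<^sup>*\<close>. This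
  replaces the usual appeal to uniqueness for the initial value problem.\<close>

lemma matrix_solution_real_det:
  assumes "matrix_solution p q 0 U" and x: "x \<in> {0..1}"
  shows "U x $ 1 $ 1 * U x $ 2 $ 2 - U x $ 2 $ 1 * U x $ 1 $ 2 = 1"
    and "U x $ i $ j \<in> \<real>"
proof -
  note U = matrix_solution_columns[OF assms(1)]
  have cU: "AE x in lebesgue_on {0..1}.
        ((\<lambda>x. cnj (U x $ 1 $ j)) has_vector_derivative
            of_real (q x) * cnj (U x $ 1 $ j) - of_real (p x) * cnj (U x $ 2 $ j)) (at x within {0..1}) \<and>
        ((\<lambda>x. cnj (U x $ 2 $ j)) has_vector_derivative
            - of_real (p x) * cnj (U x $ 1 $ j) - of_real (q x) * cnj (U x $ 2 $ j)) (at x within {0..1})" for j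
    using U(3)[of j]
  proof eventually_elim
    case (elim x)
    show ?case
      using bounded_linear.has_vector_derivative[OF bounded_linear_cnj conjunct1[OF elim]]
        bounded_linear.has_vector_derivative[OF bounded_linear_cnj conjunct2[OF elim]]
      by simp
  qed
  have acc: "absolutely_continuous_fun_on {0..1} (\<lambda>x. cnj (U x $ i $ j))" for i j
    by (intro absolutely_continuous_fun_on_bounded_linear[OF U(1) bounded_linear_cnj])
  show det: "U x $ 1 $ 1 * U x $ 2 $ 2 - U x $ 2 $ 1 * U x $ 1 $ 2 = 1"
    using wronskian_constant[OF U(1) U(1) U(1) U(1) U(3) U(3) x, of 1 2] by (simp add: U(2))
  have W: "cnj (U x $ 1 $ j) * U x $ 2 $ k - cnj (U x $ 2 $ j) * U x $ 1 $ k =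
      cnj (U 0 $ 1 $ j) * U 0 $ 2 $ k - cnj (U 0 $ 2 $ j) * U 0 $ 1 $ k" for j k
    using wronskian_constant[OF acc acc U(1) U(1) cU U(3) x, of j k] .
  \<comment> \<open>Cancellation of \<open>J U\<close> in coordinates; capital letters are the conjugates.\<close>
  have *: "A = a" "C = c" "B = b" "D = d"
    if "A * c - C * a = 0" "A * d - C * b = 1" "B * c - D * a = - 1" "B * d - D * b = 0"
      "a * d - c * b = 1" for a b c d A B C D :: complex
    using that by algebra+
  have "cnj (U x $ 1 $ 1) = U x $ 1 $ 1" "cnj (U x $ 2 $ 1) = U x $ 2 $ 1"
    "cnj (U x $ 1 $ 2) = U x $ 1 $ 2" "cnj (U x $ 2 $ 2) = U x $ 2 $ 2"
    using *[of "cnj (U x $ 1 $ 1)" "U x $ 2 $ 1" "cnj (U x $ 2 $ 1)" "U x $ 1 $ 1" "U x $ 2 $ 2"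
        "U x $ 1 $ 2" "cnj (U x $ 1 $ 2)" "cnj (U x $ 2 $ 2)"] det
      W[of 1 1] W[of 1 2] W[of 2 1] W[of 2 2] by (simp_all add: U(2))
  then have "cnj (U x $ i $ j) = U x $ i $ j"
    using exhaust_2[of i] exhaust_2[of j] by auto
  then show "U x $ i $ j \<in> \<real>" by (simp add: Reals_cnj_iff)
qed

section \<open>The zeroth coefficient and the recovery of the potential\<close>

lemma matrix_exp_0: "matrix_exp 0 = mat 1"
proof -
  have "((**) 0 ^^ n) (mat 1) = (if n = 0 then mat 1 else 0 :: complex^2^2)" for n
    by (cases n) (auto simp: matrix_matrix_mult_def zero_vec_def)
  then have "matrix_exp 0 = (\<Sum>n. if n = 0 then mat 1 else 0)"
    unfolding matrix_exp_def by (intro suminf_cong) auto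
  also have "\<dots> = mat 1"
    by (subst suminf_finite[of "{0}"]) auto
  finally show ?thesis .
qed

text \<open>At \<open>\<lambda> = 0\<close> the exponentials are the identity, and the zeroth Legendre polynomial is the constant
  one. So the integral in the transmutation formula and the one defining the coefficient are the same.\<close>

lemma kernel_coeff_0:
  assumes "transmutation_kernel U K" "x \<in> {0..1}"
  shows "kernel_coeff K 0 x = (1 / 2) *\<^sub>R (U 0 x - mat 1)"
proof -
  \<comment> \<open>The exponent \<open>- \<mu> * t\<close> at \<open>\<mu> = 0\<close>, in the form in which instantiation produces it.\<close>
  have z: "mat (- 0 * of_real t) ** B_mat = 0" for t
    by (simp add: mat_def matrix_matrix_mult_def zero_vec_def)
  have "U 0 x = matrix_exp (mat (- 0 * of_real x) ** B_mat) +
      (LINT t|lebesgue_on {-x..x}. K x t ** matrix_exp (mat (- 0 * of_real t) ** B_mat))"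
    using assms unfolding transmutation_kernel_def by blast
  then have "U 0 x = mat 1 + (LINT t|lebesgue_on {-x..x}. K x t)"
    unfolding z matrix_exp_0 matrix_mul_rid .
  then show ?thesis
    by (simp add: kernel_coeff_def legendre_poly_def)
qed

text \<open>Both formulas of the theorem are cases of this one. The assumptions say that
  \<open>u = (Y, Z) = (2 c - S, C + 2 d)\<close> is the solution \<open>U v\<close> with initial value \<open>v = (- S, C)\<close>. The equations
  \<open>Y' = q Y - p Z\<close> and \<open>Z' = - p Y - q Z\<close> are linear in \<open>p\<close> and \<open>q\<close> with determinant
  \<open>Y\<^sup>2 + Z\<^sup>2\<close>, and Cramer's rule gives the claim. The determinant vanishes nowhere: \<open>u\<close> is real, so it
  could vanish only where \<open>u = 0\<close>, and this is excluded by \<open>v \<noteq> 0\<close> and the invertibility of \<open>U\<close>.\<close>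

lemma potential_recovery:
  fixes S C :: real
  assumes U: "matrix_solution p q 0 U" and SC: "S \<noteq> 0 \<or> C \<noteq> 0"
    and c: "\<And>x. x \<in> {0..1} \<Longrightarrow> 2 * c x - of_real S = - of_real S * U x $ 1 $ 1 + of_real C * U x $ 1 $ 2"
    and d: "\<And>x. x \<in> {0..1} \<Longrightarrow> of_real C + 2 * d x = - of_real S * U x $ 2 $ 1 + of_real C * U x $ 2 $ 2"
  shows "AE x in lebesgue_on {0..1}. \<exists>c' d'.
           (c has_vector_derivative c') (at x within {0..1}) \<and>
           (d has_vector_derivative d') (at x within {0..1}) \<and>
           (of_real C + 2 * d x)\<^sup>2 + (of_real S - 2 * c x)\<^sup>2 \<noteq> 0 \<and>
           (vector [of_real (p x), of_real (q x)] :: complex^2) =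
             (1 / ((of_real C + 2 * d x)\<^sup>2 + (of_real S - 2 * c x)\<^sup>2)) *s
               ((vector [vector [- (of_real C + 2 * d x), of_real S - 2 * c x],
                         vector [- of_real S + 2 * c x, - (of_real C + 2 * d x)]] :: complex^2^2) *v
                vector [2 * c', 2 * d'])"
  using matrix_solution_columns(3)[OF U, of 1] matrix_solution_columns(3)[OF U, of 2]
    AE_space
proof eventually_elim
  case (elim x)
  then have x: "x \<in> {0..1}" by simp
  let ?s = "of_real S :: complex" and ?k = "of_real C :: complex"
    and ?p = "of_real (p x) :: complex" and ?q = "of_real (q x) :: complex"
  define Y where "Y x = - ?s * U x $ 1 $ 1 + ?k * U x $ 1 $ 2" for x
  define Z where "Z x = - ?s * U x $ 2 $ 1 + ?k * U x $ 2 $ 2" for x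
  have Y': "(Y has_vector_derivative ?q * Y x - ?p * Z x) (at x within {0..1})"
    unfolding Y_def Z_def using elim
    by (auto intro!: derivative_eq_intros simp: algebra_simps)
  have Z': "(Z has_vector_derivative - ?p * Y x - ?q * Z x) (at x within {0..1})"
    unfolding Y_def Z_def using elim
    by (auto intro!: derivative_eq_intros simp: algebra_simps)
  have c': "(c has_vector_derivative (?q * Y x - ?p * Z x) / 2) (at x within {0..1})"
  proof (rule has_vector_derivative_transform[OF x])
    show "c x = (Y x + ?s) / 2" if "x \<in> {0..1}" for x
      using c[OF that] by (simp add: Y_def field_simps)
    show "((\<lambda>x. (Y x + ?s) / 2) has_vector_derivative (?q * Y x - ?p * Z x) / 2) (at x within {0..1})"
      using Y' by (auto intro!: derivative_eq_intros)
  qed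
  have d': "(d has_vector_derivative (- ?p * Y x - ?q * Z x) / 2) (at x within {0..1})"
  proof (rule has_vector_derivative_transform[OF x])
    show "d x = (Z x - ?k) / 2" if "x \<in> {0..1}" for x
      using d[OF that] by (simp add: Z_def field_simps)
    show "((\<lambda>x. (Z x - ?k) / 2) has_vector_derivative (- ?p * Y x - ?q * Z x) / 2) (at x within {0..1})"
      using Z' by (auto intro!: derivative_eq_intros)
  qed
  have nz: "(Z x)\<^sup>2 + (Y x)\<^sup>2 \<noteq> 0"
  proof
    assume 0: "(Z x)\<^sup>2 + (Y x)\<^sup>2 = 0"
    note real = matrix_solution_real_det(2)[OF U x]
    have "Y x \<in> \<real>" "Z x \<in> \<real>"
      using real by (auto simp: Y_def Z_def)
    then obtain y z where yz: "Y x = of_real y" "Z x = of_real z" by (metis Reals_cases)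
    then have "of_real (z\<^sup>2 + y\<^sup>2) = (0 :: complex)" using 0 by simp
    then have "z\<^sup>2 + y\<^sup>2 = 0" by (simp only: of_real_eq_0_iff)
    then have "Y x = 0" "Z x = 0" using yz by (auto simp: sum_power2_eq_zero_iff)
    then have "?s = 0" "?k = 0"
      using matrix_solution_real_det(1)[OF U x] unfolding Y_def Z_def by algebra+
    then show False using SC by simp
  qed
  have C: "?k + 2 * d x = Z x" and S: "?s - 2 * c x = - Y x" "- ?s + 2 * c x = Y x"
    using c[OF x] d[OF x] by (simp_all add: Y_def Z_def algebra_simps)
  have "- Z x * (?q * Y x - ?p * Z x) + - Y x * (- ?p * Y x - ?q * Z x) = ((Z x)\<^sup>2 + (Y x)\<^sup>2) * ?p"
    "Y x * (?q * Y x - ?p * Z x) + - Z x * (- ?p * Y x - ?q * Z x) = ((Z x)\<^sup>2 + (Y x)\<^sup>2) * ?q"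
    by algebra+
  then have potential: "(vector [?p, ?q] :: complex^2) =
      (1 / ((Z x)\<^sup>2 + (Y x)\<^sup>2)) *s ((vector [vector [- Z x, - Y x], vector [Y x, - Z x]] :: complex^2^2) *v
        vector [?q * Y x - ?p * Z x, - ?p * Y x - ?q * Z x])"
    using nz by (simp add: vec_eq_iff forall_2 matrix_vector_mult_def sum_2)
  show ?case
    unfolding C S power2_minus
  proof (intro exI conjI)
    show "(c has_vector_derivative (?q * Y x - ?p * Z x) / 2) (at x within {0..1})"
      and "(d has_vector_derivative (- ?p * Y x - ?q * Z x) / 2) (at x within {0..1})"
      by (fact c' d')+
    have half: "2 * (w / 2) = w" for w :: complex by simp
    show "(vector [?p, ?q] :: complex^2) =
      (1 / ((Z x)\<^sup>2 + (Y x)\<^sup>2)) *s ((vector [vector [- Z x, - Y x], vector [Y x, - Z x]] :: complex^2^2) *v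
        vector [2 * ((?q * Y x - ?p * Z x) / 2), 2 * ((- ?p * Y x - ?q * Z x) / 2)])"
      unfolding half by (fact potential)
  qed (fact nz)
qed

theorem proposition5p11:
  fixes p q :: "real \<Rightarrow> real" and \<alpha> :: real
    and U :: "complex \<Rightarrow> real \<Rightarrow> complex^2^2"
    and K :: "real \<Rightarrow> real \<Rightarrow> complex^2^2"
  assumes p: "p square_integrable_on {0..1}"
    and q: "q square_integrable_on {0..1}"
    and \<alpha>: "\<alpha> \<in> {-pi/2..<pi/2}"
    and U: "\<And>\<mu>. matrix_solution p q \<mu> (U \<mu>)"
    and K: "transmutation_kernel U K"
  shows
    "(let c = (\<lambda>x. column 2 (K_S K 0 x) $ 1);
          d = (\<lambda>x. column 2 (K_S K 0 x) $ 2)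
      in AE x in lebesgue_on {0..1}. \<exists>c' d'.
           (c has_vector_derivative c') (at x within {0..1}) \<and>
           (d has_vector_derivative d') (at x within {0..1}) \<and>
           (1 + 2 * d x)\<^sup>2 + 4 * (c x)\<^sup>2 \<noteq> 0 \<and>
           (vector [of_real (p x), of_real (q x)] :: complex^2) =
             (1 / ((1 + 2 * d x)\<^sup>2 + 4 * (c x)\<^sup>2)) *s
               ((vector [vector [- (1 + 2 * d x), - 2 * c x],
                         vector [2 * c x, - (1 + 2 * d x)]] :: complex^2^2) *v
                vector [2 * c', 2 * d']))
     \<and>
     (let c = (\<lambda>x. column 2 (K_alpha \<alpha> K 0 x) $ 1);
          d = (\<lambda>x. column 2 (K_alpha \<alpha> K 0 x) $ 2);
          C = complex_of_real (cos \<alpha>);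
          S = complex_of_real (sin \<alpha>)
      in AE x in lebesgue_on {0..1}. \<exists>c' d'.
           (c has_vector_derivative c') (at x within {0..1}) \<and>
           (d has_vector_derivative d') (at x within {0..1}) \<and>
           (C + 2 * d x)\<^sup>2 + (S - 2 * c x)\<^sup>2 \<noteq> 0 \<and>
           (vector [of_real (p x), of_real (q x)] :: complex^2) =
             (1 / ((C + 2 * d x)\<^sup>2 + (S - 2 * c x)\<^sup>2)) *s
               ((vector [vector [- (C + 2 * d x), S - 2 * c x],
                         vector [- S + 2 * c x, - (C + 2 * d x)]] :: complex^2^2) *v
                vector [2 * c', 2 * d']))"
proof -
  note sol = U[of 0]
  have K0: "kernel_coeff K 0 x $ i $ j = (U 0 x $ i $ j - (if i = j then 1 else 0)) / 2"
    if "x \<in> {0..1}" for x i j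
    by (simp only: kernel_coeff_0[OF K that] vector_scaleR_component vector_minus_component)
       (simp add: mat_def scaleR_conv_of_real)
  have trig: "sin \<alpha> \<noteq> 0 \<or> cos \<alpha> \<noteq> 0"
    using sin_cos_squared_add[of \<alpha>] by fastforce
  show ?thesis
    unfolding Let_def
  proof (rule conjI, goal_cases)
    \<comment> \<open>The initial value is the second unit vector.\<close>
    case 1
    let ?c = "\<lambda>x. column 2 (K_S K 0 x) $ 1" and ?d = "\<lambda>x. column 2 (K_S K 0 x) $ 2"
    have "2 * ?c x - of_real 0 = - of_real 0 * U 0 x $ 1 $ 1 + of_real 1 * U 0 x $ 1 $ 2"
      "of_real 1 + 2 * ?d x = - of_real 0 * U 0 x $ 2 $ 1 + of_real 1 * U 0 x $ 2 $ 2"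
      if "x \<in> {0..1}" for x
      by (simp_all add: column_def K_S_def Let_def K0[OF that] field_simps)
    then show ?case
      using potential_recovery[OF sol, of 0 1 ?c ?d] by (simp add: power_mult_distrib)
  next
    \<comment> \<open>The second column is the zeroth coefficient applied to \<open>(- sin \<alpha>, cos \<alpha>)\<close>, which is the initial value.\<close>
    case 2
    show ?case
      by (intro potential_recovery[OF sol] trig)
         (simp_all add: column_def K_alpha_def Let_def K0 field_simps)
  qed
qed

end
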